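(* Let $m,n$ be nonnegative integers and let $r$ be an integer (possibly negative) with $r\le m$ and $r\le n$. The set $\mathcal{IC}(P_{m\times n;r})$ of interval-closed sets of $P_{m\times n;r}$ is in bijection with the set of lattice walks in the first quadrant $\{(x,y):x,y\ge0\}$ starting at $(n-r,0)$ and ending at $(m-r,0)$, and consisting of $m+n$ steps from the set $\{\mathtt{e},\mathtt{w},\mathtt{se},\mathtt{nw}\}$, where no $\mathtt{w}$ step on the $x$-axis is immediately followed by an $\mathtt{e}$ step.
   Context: For a finite poset $P$, a subset $I\subseteq P$ is an interval-closed set if for all $a,b\in I$ and $z\in P$ with $a<z<b$ we have $z\in I$; $\mathcal{IC}(P)$ is the set of all interval-closed sets of $P$ (including the empty set). $[m]\times[n]=\{(i,j): 1\le i\le m,\ 1\le j\le n\}$ is ordered componentwise. For $r\ge0$, $P_{m\times n;r}$ is the poset obtained from $[m]\times[n]$ by truncating (removing) its bottom $r$ ranks, i.e. $P_{m\times n;r}=\{(a,b)\in[m]\times[n]: a+b-2\ge r\}$ with the induced order; for $r<0$, $P_{m\times n;r}=P_{m\times n;0}=[m]\times[n]$. The steps are $\mathtt{e}=(1,0)$, $\mathtt{w}=(-1,0)$, $\mathtt{se}=(1,-1)$, $\mathtt{nw}=(-1,1)$. Walks must stay in the first quadrant at all times. *)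

theory Defs
  imports Main "HOL-Library.Product_Order" "HOL-Library.Product_Plus"
begin

text \<open>Pairs carry the componentwise order of \<^theory>\<open>HOL-Library.Product_Order\<close> and the
  componentwise addition of \<^theory>\<open>HOL-Library.Product_Plus\<close>.\<close>

definition interval_closed_sets :: "'a::order set \<Rightarrow> 'a set set" where
  "interval_closed_sets P =
     {I. I \<subseteq> P \<and> (\<forall>a\<in>I. \<forall>b\<in>I. \<forall>z\<in>P. a < z \<and> z < b \<longrightarrow> z \<in> I)}"

text \<open>The product of chains \<open>[m] \<times> [n]\<close> with its bottom \<open>r\<close> ranks removed; the rank of
  \<open>(a, b)\<close> is \<open>a + b - 2 \<ge> 0\<close>. For negative \<open>r\<close> the rank condition is
  vacuous, so the result is all of \<open>[m] \<times> [n]\<close>, as for \<open>r = 0\<close>.\<close>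

definition truncated_rectangle :: "nat \<Rightarrow> nat \<Rightarrow> int \<Rightarrow> (nat \<times> nat) set" where
  "truncated_rectangle m n r = {(a, b) \<in> {1..m} \<times> {1..n}. int a + int b - 2 \<ge> r}"

abbreviation step_e :: "int \<times> int" where "step_e \<equiv> (1, 0)"
abbreviation step_w :: "int \<times> int" where "step_w \<equiv> (-1, 0)"
abbreviation step_se :: "int \<times> int" where "step_se \<equiv> (1, -1)"
abbreviation step_nw :: "int \<times> int" where "step_nw \<equiv> (-1, 1)"

text \<open>A walk is given by its starting point and its list of steps.\<close>

definition walk_position :: "int \<times> int \<Rightarrow> (int \<times> int) list \<Rightarrow> nat \<Rightarrow> int \<times> int" where
  "walk_position s ws k = s + sum_list (take k ws)"

definition first_quadrant :: "(int \<times> int) set" where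
  "first_quadrant = {(x, y). x \<ge> 0 \<and> y \<ge> 0}"

definition quadrant_walks ::
  "(int \<times> int) set \<Rightarrow> int \<times> int \<Rightarrow> int \<times> int \<Rightarrow> nat \<Rightarrow> (int \<times> int) list set" where
  "quadrant_walks S s t N =
     {ws. length ws = N \<and> set ws \<subseteq> S \<and>
          (\<forall>k\<le>N. walk_position s ws k \<in> first_quadrant) \<and>
          walk_position s ws N = t}"

text \<open>The step with index \<open>i\<close> starts at the position reached after \<open>i\<close> steps; a \<open>w\<close>
  step lies on the x-axis iff it starts there.\<close>

definition no_w_e_on_axis :: "int \<times> int \<Rightarrow> (int \<times> int) list \<Rightarrow> bool" where
  "no_w_e_on_axis s ws \<longleftrightarrow>
     (\<forall>i. Suc i < length ws \<longrightarrow>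
        \<not> (ws ! i = step_w \<and> snd (walk_position s ws i) = 0 \<and> ws ! Suc i = step_e))"

end

theory Submission imports Defs begin

text \<open>
  A walk of the theorem is a pair of nested staircase paths in disguise.  At a position
  \<open>(x, y)\<close> put a lower path at height \<open>x\<close> and an upper path at height \<open>x + 2 y\<close>: each of the
  four steps moves both of them by \<open>1\<close> up or down, all four combinations occur, and the
  quadrant says that the lower path stays at height at least \<open>0\<close> and weakly below the upper
  one.  Draw the rectangle with its corner \<open>(1, 1)\<close> at the bottom, so that the element
  \<open>(a, b)\<close> is a square standing on a corner, centred at time \<open>a + n - b\<close>.  Both paths
  then run along the edges of squares from the left to the right corner of the rectangle, the
  truncated rectangle consists of the squares that do not reach below height \<open>0\<close>, and the
  elements above a path form an up-set of it.  Every up-set arises from exactly one path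
  (\<open>exists_staircase_of_upset\<close>, \<open>staircase_le_if_above_subset\<close>).

  So a walk encodes two up-sets \<open>G \<subseteq> F\<close>, and the difference \<open>F - G\<close>, the region between
  the paths, is interval-closed.  An interval-closed set \<open>I\<close> can have many such descriptions, but
  there is a canonical one, in which \<open>F\<close> is as small as possible, namely the up-set generated
  by \<open>I\<close>; the set \<open>F - I\<close> is then automatically an up-set.  It remains to recognise the
  canonical pairs: \<open>F\<close> is generated by \<open>F - G\<close> iff all minimal elements of \<open>F\<close> lie outside
  \<open>G\<close>.  The minimal elements of \<open>F\<close> are the squares resting in the valleys of the lower path,
  and such a square belongs to \<open>G\<close> iff the upper path runs through the same valley, which is
  to say that the walk makes a \<open>w\<close> step on the axis followed by an \<open>e\<close> step.  One direction
  is \<open>region_generates_above\<close>, the other is part of \<open>exists_staircases_of_interval_closed\<close>.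
\<close>

section \<open>Staircase paths and up-sets\<close>

text \<open>A path of \<open>m\<close> up-steps and \<open>n\<close> down-steps is recorded by the number \<open>u k\<close> of up-steps
  among its first \<open>k\<close> steps.  Starting at height \<open>n - r\<close> it has height \<open>n - r - k + 2 u k\<close> at
  time \<open>k\<close>; the last condition says that this is nonnegative.\<close>

definition staircase :: "nat \<Rightarrow> nat \<Rightarrow> int \<Rightarrow> (nat \<Rightarrow> nat) \<Rightarrow> bool" where
  "staircase m n r u \<longleftrightarrow> u 0 = 0 \<and> u (m + n) = m \<and>
     (\<forall>k<m + n. u (Suc k) = u k \<or> u (Suc k) = Suc (u k)) \<and>
     (\<forall>k\<le>m + n. int k + r \<le> int n + 2 * int (u k))"

text \<open>The centre of the square \<open>(a, b)\<close> has time \<open>k = a + n - b\<close> and height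
  \<open>a + b - 1 - r = n - r - k + (2 a - 1)\<close>, so it lies above the path iff \<open>u k < a\<close>.\<close>

definition above :: "nat \<Rightarrow> nat \<Rightarrow> int \<Rightarrow> (nat \<Rightarrow> nat) \<Rightarrow> (nat \<times> nat) set" where
  "above m n r u = {(a, b) \<in> truncated_rectangle m n r. u (a + n - b) < a}"

lemma mem_truncated_rectangle:
  "(a, b) \<in> truncated_rectangle m n r \<longleftrightarrow>
     1 \<le> a \<and> a \<le> m \<and> 1 \<le> b \<and> b \<le> n \<and> r \<le> int a + int b - 2"
  by (auto simp: truncated_rectangle_def)

lemma mem_above:
  "(a, b) \<in> above m n r u \<longleftrightarrow> (a, b) \<in> truncated_rectangle m n r \<and> u (a + n - b) < a"
  by (auto simp: above_def)

lemma staircase_step: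
  assumes "staircase m n r u" "k < m + n"
  shows "u k \<le> u (Suc k)" "u (Suc k) \<le> Suc (u k)"
  using assms by (auto simp: staircase_def)

lemma staircase_growth:
  assumes "staircase m n r u" "i + d \<le> m + n"
  shows "u i \<le> u (i + d) \<and> u (i + d) \<le> u i + d"
  using assms(2)
proof (induction d)
  case (Suc d)
  then show ?case
    using staircase_step[OF assms(1), of "i + d"] by simp
qed simp

lemma staircase_bounds:
  assumes "staircase m n r u" "k \<le> m + n"
  shows "u k \<le> k" "u k \<le> m" "k \<le> n + u k" "int k + r \<le> int n + 2 * int (u k)"
proof -
  have ends: "u 0 = 0" "u (m + n) = m"
    using assms(1) by (auto simp: staircase_def)
  show "u k \<le> k"
    using staircase_growth[OF assms(1), of 0 k] assms(2) ends by simp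
  show "u k \<le> m" "k \<le> n + u k"
    using staircase_growth[OF assms(1), of k "m + n - k"] assms(2) ends by auto
  show "int k + r \<le> int n + 2 * int (u k)"
    using assms by (auto simp: staircase_def)
qed

text \<open>A path stays so close to the boundary of the truncated rectangle that a square above it
  cannot violate the bounds \<open>1 \<le> a\<close>, \<open>1 \<le> b\<close> and the rank condition; only the upper bounds
  \<open>a \<le> m\<close> and \<open>b \<le> n\<close>, which is \<open>a \<le> k\<close>, have to be checked.\<close>

lemma above_staircaseI:
  assumes "staircase m n r u" "k \<le> m + n" "u k < a" "a \<le> m" "a \<le> k"
  shows "(a, a + n - k) \<in> above m n r u"
proof -
  have "k < n + a"
    using staircase_bounds(3)[OF assms(1,2)] assms(3) by simp
  moreover have "int k + r \<le> int n + 2 * int (a - 1)"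
    using staircase_bounds(4)[OF assms(1,2)] assms(3) by auto
  ultimately show ?thesis
    using assms by (auto simp: mem_above mem_truncated_rectangle)
qed

lemma above_upward_closed:
  assumes u: "staircase m n r u" and p: "p \<in> above m n r u"
    and q: "q \<in> truncated_rectangle m n r" and le: "p \<le> q"
  shows "q \<in> above m n r u"
proof -
  obtain a b c d where [simp]: "p = (a, b)" "q = (c, d)"
    by (cases p, cases q)
  have ab: "1 \<le> a" "b \<le> n" "u (a + n - b) < a" "a \<le> m" "1 \<le> b"
    using p by (auto simp: mem_above mem_truncated_rectangle)
  have cd: "c \<le> m" "1 \<le> d" "d \<le> n" "a \<le> c" "b \<le> d"
    using q le by (auto simp: mem_truncated_rectangle)
  define s t where "s = a + n - b" and "t = c + n - d"
  have st: "s \<le> m + n" "t \<le> m + n" "t + a \<le> s + c"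
    using ab cd by (auto simp: s_def t_def)
  have us: "u s < a"
    using ab by (simp add: s_def)
  have "u t < c"
  proof (cases "t \<le> s")
    case True
    then show ?thesis
      using staircase_growth[OF u, of t "s - t"] st us cd by simp
  next
    case False
    then show ?thesis
      using staircase_growth[OF u, of s "t - s"] st us by force
  qed
  then show ?thesis
    using q by (simp add: mem_above t_def)
qed

text \<open>Where \<open>v\<close> runs strictly below \<open>u\<close>, the square directly below \<open>u\<close> separates the two
  up-sets.\<close>

lemma staircase_le_if_above_subset:
  assumes u: "staircase m n r u" and v: "staircase m n r v"
    and sub: "above m n r v \<subseteq> above m n r u" and k: "k \<le> m + n"
  shows "u k \<le> v k"
proof (rule ccontr)
  assume "\<not> u k \<le> v k"
  then have "(u k, u k + n - k) \<in> above m n r v"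
    using above_staircaseI[OF v k] staircase_bounds[OF u k] by simp
  then have "(u k, u k + n - k) \<in> above m n r u"
    using sub by blast
  moreover have "u k + n - (u k + n - k) = k"
    using staircase_bounds[OF v k] \<open>\<not> u k \<le> v k\<close> by simp
  ultimately show False
    by (simp add: mem_above)
qed

text \<open>Extend the up-set to the squares outside the rectangle with \<open>a > m\<close> or \<open>b > n\<close>.  On the
  line of time \<open>k\<close> the path passes just below the lowest square of the extended up-set; here
  the square \<open>(x + 1, x + 1 + n - k)\<close> is represented by \<open>x\<close>.  Since the extended up-set is
  closed under raising either coordinate, the lowest squares at neighbouring times differ by a
  single step.\<close>

lemma exists_staircase_of_upset:
  assumes rm: "r \<le> int m" and rn: "r \<le> int n"
    and F: "F \<subseteq> truncated_rectangle m n r"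
    and up: "\<And>p q. p \<in> F \<Longrightarrow> q \<in> truncated_rectangle m n r \<Longrightarrow> p \<le> q \<Longrightarrow> q \<in> F"
  shows "\<exists>u. staircase m n r u \<and> above m n r u = F"
proof -
  define Q where "Q k x \<longleftrightarrow> k \<le> n + x \<and> int k + r \<le> int n + 2 * int x \<and>
      (m \<le> x \<or> k \<le> x \<or> (Suc x, Suc x + n - k) \<in> F)" for k x
  define u where "u k = (LEAST x. Q k x)" for k
  have raise_a: "Q (Suc k) (Suc x)" if "Q k x" for k x
  proof (cases "m \<le> Suc x \<or> k \<le> x")
    case True
    then show ?thesis
      using that by (auto simp: Q_def)
  next
    case False
    then have *: "(Suc x, Suc x + n - k) \<in> F"
      using that by (auto simp: Q_def)
    then have "(Suc x, Suc x + n - k) \<in> truncated_rectangle m n r"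
      using F by blast
    then have "(Suc (Suc x), Suc x + n - k) \<in> truncated_rectangle m n r"
      using False by (auto simp: mem_truncated_rectangle)
    from up[OF * this] show ?thesis
      using that by (auto simp: Q_def)
  qed
  have raise_b: "Q k x" if "Q (Suc k) x" for k x
  proof (cases "m \<le> x \<or> k \<le> x")
    case True
    then show ?thesis
      using that by (auto simp: Q_def)
  next
    case False
    then have *: "(Suc x, Suc x + n - Suc k) \<in> F"
      using that by (auto simp: Q_def)
    then have "(Suc x, Suc x + n - Suc k) \<in> truncated_rectangle m n r"
      using F by blast
    then have "(Suc x, Suc x + n - k) \<in> truncated_rectangle m n r"
      using False that by (auto simp: mem_truncated_rectangle Q_def)
    from up[OF * this] show ?thesis
      using that by (auto simp: Q_def)
  qed
  have mono: "Q k y" if "Q k x" "x \<le> y" for k x y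
    using that(2) by (induction rule: dec_induct) (use that(1) raise_b[OF raise_a] in blast)+
  have least: "Q k (u k)" for k
  proof -
    have "Q k (k + m)"
      using rn rm by (auto simp: Q_def)
    then show ?thesis
      unfolding u_def by (rule LeastI)
  qed
  have le: "u k \<le> x" if "Q k x" for k x
    unfolding u_def using that by (rule Least_le)
  have "u (Suc k) = u k \<or> u (Suc k) = Suc (u k)" for k
    using le[OF raise_a[OF least[of k]]] le[OF raise_b[OF least[of "Suc k"]]] by linarith
  moreover have "u 0 = 0"
    using le[of 0 0] rn by (simp add: Q_def)
  moreover have "u (m + n) = m"
    using le[of "m + n" m] least[of "m + n"] rm by (simp add: Q_def)
  moreover have "int k + r \<le> int n + 2 * int (u k)" for k
    using least[of k] by (simp add: Q_def)
  ultimately have "staircase m n r u"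
    by (simp add: staircase_def)
  moreover have "p \<in> above m n r u \<longleftrightarrow> p \<in> F" if p: "p \<in> truncated_rectangle m n r" for p
  proof -
    obtain a b where [simp]: "p = (a, b)"
      by (cases p)
    have ab: "1 \<le> a" "a \<le> m" "1 \<le> b" "b \<le> n" "r \<le> int a + int b - 2"
      using p by (auto simp: mem_truncated_rectangle)
    then have "Q (a + n - b) (a - 1) \<longleftrightarrow> p \<in> F"
      by (auto simp: Q_def)
    moreover have "Q (a + n - b) (a - 1) \<longleftrightarrow> u (a + n - b) \<le> a - 1"
      using le mono least by blast
    ultimately show ?thesis
      using ab p by (auto simp: mem_above)
  qed
  then have "above m n r u = F"
    using F by (auto simp: mem_above)
  ultimately show ?thesis
    by blast
qed

section \<open>Interval-closed sets and nested paths without a common valley\<close>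

definition nested_staircases :: "nat \<Rightarrow> nat \<Rightarrow> int \<Rightarrow> (nat \<Rightarrow> nat) \<Rightarrow> (nat \<Rightarrow> nat) \<Rightarrow> bool" where
  "nested_staircases m n r u v \<longleftrightarrow> staircase m n r u \<and> staircase m n r v \<and>
     (\<forall>k\<le>m + n. u k \<le> v k)"

text \<open>As the paths are nested, a valley of the lower path at which they meet is also a valley of
  the upper one.\<close>

definition common_valley :: "(nat \<Rightarrow> nat) \<Rightarrow> (nat \<Rightarrow> nat) \<Rightarrow> nat \<Rightarrow> bool" where
  "common_valley u v k \<longleftrightarrow>
     u (Suc k) = u k \<and> u (Suc (Suc k)) = Suc (u (Suc k)) \<and> v (Suc k) = u (Suc k)"

text \<open>From a square above both paths it is always possible to descend to a square that is still
  above the lower path, unless the square rests in a common valley.\<close>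

lemma region_generates_above:
  assumes uv: "nested_staircases m n r u v"
    and nv: "\<And>k. Suc k < m + n \<Longrightarrow> \<not> common_valley u v k"
    and p: "p \<in> above m n r u"
  shows "\<exists>q\<in>above m n r u - above m n r v. q \<le> p"
  using p
proof (induction "fst p + snd p" arbitrary: p rule: less_induct)
  case less
  obtain a b where [simp]: "p = (a, b)"
    by (cases p)
  have u: "staircase m n r u" and v: "staircase m n r v"
    using uv by (auto simp: nested_staircases_def)
  define k where "k = a + n - Suc b"
  have ab: "1 \<le> a" "a \<le> m" "1 \<le> b" "b \<le> n"
    using less.prems by (auto simp: mem_above mem_truncated_rectangle)
  then have k: "Suc k = a + n - b" "Suc k < m + n" "a \<le> Suc k"
    by (auto simp: k_def)
  have ua: "u (Suc k) < a"
    using less.prems k by (simp add: mem_above)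
  have descend: ?case if q: "q \<in> above m n r u" "q < p" for q
  proof -
    have "fst q + snd q < fst p + snd p"
      using q(2) by (cases q) (auto simp: less_le_not_le)
    from less.hyps[OF this q(1)] show ?thesis
      using q(2) by (meson order.strict_implies_order order.trans)
  qed
  show ?case
  proof (cases "p \<in> above m n r v")
    case False
    then show ?thesis
      using less.prems by blast
  next
    case True
    then have va: "v (Suc k) < a"
      using k by (simp add: mem_above)
    show ?thesis
    proof (cases "u k < a - 1")
      case True
      have "(a - 1, a - 1 + n - k) \<in> above m n r u"
        using above_staircaseI[OF u, of k "a - 1"] True k ab by simp
      moreover have "a - 1 + n - k = b"
        using k ab by simp
      ultimately show ?thesis
        using descend[of "(a - 1, b)"] ab by (auto simp: less_le_not_le)
    next
      case False
      moreover have "u k \<le> u (Suc k)"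
        using staircase_step[OF u, of k] k by simp
      moreover have "u (Suc k) \<le> v (Suc k)"
        using uv k by (simp add: nested_staircases_def)
      ultimately have "u k = a - 1" "u (Suc k) = a - 1" "v (Suc k) = a - 1"
        using va by linarith+
      then have "u (Suc (Suc k)) < a"
        using nv[of k] staircase_step[OF u, of "Suc k"] k ua
        by (auto simp: common_valley_def)
      moreover have "a \<le> Suc (Suc k)" "Suc (Suc k) \<le> m + n"
        using k by auto
      ultimately have *: "(a, a + n - Suc (Suc k)) \<in> above m n r u"
        using above_staircaseI[OF u] ab by blast
      moreover have "a + n - Suc (Suc k) = b - 1"
        using k by simp
      ultimately show ?thesis
        using descend[of "(a, b - 1)"] ab by (auto simp: less_le_not_le)
    qed
  qed
qed

lemma region_interval_closed:
  assumes "staircase m n r u" "staircase m n r v"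
  shows "above m n r u - above m n r v \<in> interval_closed_sets (truncated_rectangle m n r)"
  unfolding interval_closed_sets_def
proof (intro CollectI conjI ballI impI)
  show "above m n r u - above m n r v \<subseteq> truncated_rectangle m n r"
    by (auto simp: mem_above)
  fix a b z
  assume *: "a \<in> above m n r u - above m n r v" "b \<in> above m n r u - above m n r v"
    "z \<in> truncated_rectangle m n r" "a < z \<and> z < b"
  then have "b \<in> truncated_rectangle m n r"
    by (cases b) (auto simp: mem_above)
  then show "z \<in> above m n r u - above m n r v"
    using * above_upward_closed[OF assms(1), of a z] above_upward_closed[OF assms(2), of z b]
    by (meson DiffD1 DiffD2 DiffI order.strict_implies_order)
qed

text \<open>The region recovers the larger up-set as the one that it generates, the smaller one as
  the remainder, and each up-set recovers its path.\<close>

lemma region_determines_staircases: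
  assumes uv: "nested_staircases m n r u v" "\<And>k. Suc k < m + n \<Longrightarrow> \<not> common_valley u v k"
    and uv': "nested_staircases m n r u' v'" "\<And>k. Suc k < m + n \<Longrightarrow> \<not> common_valley u' v' k"
    and eq: "above m n r u - above m n r v = above m n r u' - above m n r v'"
    and k: "k \<le> m + n"
  shows "u k = u' k \<and> v k = v' k"
proof -
  have st: "staircase m n r u" "staircase m n r v" "staircase m n r u'" "staircase m n r v'"
    using uv(1) uv'(1) by (auto simp: nested_staircases_def)
  have sub: "above m n r g \<subseteq> above m n r f" if "nested_staircases m n r f g" for f g
  proof
    fix p assume p: "p \<in> above m n r g"
    obtain a b where [simp]: "p = (a, b)"
      by (cases p)
    have "a + n - b \<le> m + n"
      using p by (auto simp: mem_above mem_truncated_rectangle)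
    then have "f (a + n - b) \<le> g (a + n - b)"
      using that by (simp add: nested_staircases_def)
    then show "p \<in> above m n r f"
      using p by (simp add: mem_above)
  qed
  have gen: "above m n r f =
      {p \<in> truncated_rectangle m n r. \<exists>q\<in>above m n r f - above m n r g. q \<le> p}"
    if "nested_staircases m n r f g" "\<And>k. Suc k < m + n \<Longrightarrow> \<not> common_valley f g k" for f g
  proof -
    have f: "staircase m n r f"
      using that(1) by (simp add: nested_staircases_def)
    have "above m n r f \<subseteq> truncated_rectangle m n r"
      by (auto simp: mem_above)
    then show ?thesis
      using region_generates_above[OF that] above_upward_closed[OF f] by blast
  qed
  have "above m n r u = above m n r u'"
    using gen[OF uv] gen[OF uv'] eq by simp
  moreover from this have "above m n r v = above m n r v'"
    using sub[OF uv(1)] sub[OF uv'(1)] eq by blast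
  ultimately show ?thesis
    using staircase_le_if_above_subset st k by (metis order.antisym order.refl)
qed

text \<open>The canonical pair consists of the paths below the up-set \<open>F\<close> generated by \<open>I\<close> and below
  \<open>F - I\<close>.  The latter is an up-set because an element of \<open>F\<close> with an element of \<open>I\<close> above it
  is squeezed between two elements of \<open>I\<close>.  A square resting in a common valley would belong
  to \<open>F - I\<close>, so it would have an element of \<open>I\<close> strictly below it and hence a lower neighbour
  in \<open>F\<close>; but the squares adjacent to it from below lie below the lower path.\<close>

lemma exists_staircases_of_interval_closed:
  assumes rm: "r \<le> int m" and rn: "r \<le> int n"
    and I: "I \<in> interval_closed_sets (truncated_rectangle m n r)"
  shows "\<exists>u v. nested_staircases m n r u v \<and> (\<forall>k. Suc k < m + n \<longrightarrow> \<not> common_valley u v k) \<and>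
    above m n r u - above m n r v = I"
proof -
  define P where "P = truncated_rectangle m n r"
  define F where "F = {p \<in> P. \<exists>q\<in>I. q \<le> p}"
  have IP: "I \<subseteq> P" and ic: "\<And>a b z. \<lbrakk>a \<in> I; b \<in> I; z \<in> P; a < z; z < b\<rbrakk> \<Longrightarrow> z \<in> I"
    using I unfolding interval_closed_sets_def P_def by blast+
  have upF: "q \<in> F" if "p \<in> F" "q \<in> P" "p \<le> q" for p q
    using that unfolding F_def by (blast intro: order.trans)
  have upG: "q \<in> F - I" if p: "p \<in> F - I" "q \<in> P" "p \<le> q" for p q
  proof -
    obtain i where i: "i \<in> I" "i \<le> p"
      using p(1) unfolding F_def by blast
    have "q \<notin> I"
    proof
      assume "q \<in> I"
      moreover have "p \<in> P"
        using that(1) by (simp add: F_def)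
      ultimately have "p \<in> I"
        using i that(3) ic[of i q p] by (metis order.order_iff_strict)
      then show False
        using that by simp
    qed
    then show ?thesis
      using upF that by blast
  qed
  have FP: "F \<subseteq> P" "F - I \<subseteq> P" and IF: "I \<subseteq> F"
    using IP unfolding F_def by blast+
  obtain u where u: "staircase m n r u" "above m n r u = F"
    using exists_staircase_of_upset[OF rm rn FP(1)[unfolded P_def]] upF[unfolded P_def] by blast
  obtain v where v: "staircase m n r v" "above m n r v = F - I"
    using exists_staircase_of_upset[OF rm rn FP(2)[unfolded P_def]] upG[unfolded P_def] by blast
  have nested: "nested_staircases m n r u v"
    unfolding nested_staircases_def using staircase_le_if_above_subset u v by auto
  have region: "above m n r u - above m n r v = I"
    using u(2) v(2) IF by blast
  have "\<not> common_valley u v k" if k: "Suc k < m + n" for k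
  proof
    assume "common_valley u v k"
    then have uk: "u (Suc k) = u k" "u (Suc (Suc k)) = Suc (u k)" "v (Suc k) = u k"
      by (auto simp: common_valley_def)
    \<comment> \<open>the square \<open>(a, b)\<close> resting in the valley\<close>
    define a where "a = Suc (u k)"
    define b where "b = a + n - Suc k"
    have a: "a \<le> m" "a \<le> Suc k"
      using staircase_bounds[OF u(1), of "Suc (Suc k)"] staircase_bounds[OF u(1), of k] k uk
      by (auto simp: a_def)
    have "(a, b) \<in> F"
      using above_staircaseI[OF u(1), of "Suc k" a] a uk k u(2) by (simp add: a_def b_def)
    then obtain c d where q: "(c, d) \<in> I" "(c, d) \<le> (a, b)"
      unfolding F_def by force
    have "(a, b) \<in> above m n r v"
      using above_staircaseI[OF v(1), of "Suc k" a] a uk k by (simp add: a_def b_def)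
    then have "(a, b) \<notin> I"
      using v(2) by simp
    then have "(c, d) \<noteq> (a, b)"
      using q(1) by metis
    then have ne: "c < a \<or> d < b"
      using q(2) by auto
    have ab: "b \<le> n" "1 \<le> b" "a + n - b = Suc k"
      using a subsetD[OF FP(1) \<open>(a, b) \<in> F\<close>]
      by (auto simp: b_def P_def mem_truncated_rectangle)
    have "(c, d) \<in> P" "(c, d) \<in> above m n r u"
      using q(1) IP region by blast+
    then have cd: "1 \<le> c" "1 \<le> d" "r \<le> int c + int d - 2"
      by (auto simp: P_def mem_truncated_rectangle)
    show False
    proof (cases "c < a")
      case True
      then have "(a - 1, b) \<in> truncated_rectangle m n r"
        using cd q(2) a ab by (auto simp: mem_truncated_rectangle)
      then have "(a - 1, b) \<in> above m n r u"
        using above_upward_closed[OF u(1) \<open>(c, d) \<in> above m n r u\<close>] True q(2) by auto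
      moreover have "a - 1 + n - b = k"
        using ab True cd by simp
      ultimately show False
        by (simp add: mem_above a_def)
    next
      case False
      then have "(a, b - 1) \<in> truncated_rectangle m n r"
        using cd q(2) a ab ne by (auto simp: mem_truncated_rectangle)
      then have "(a, b - 1) \<in> above m n r u"
        using above_upward_closed[OF u(1) \<open>(c, d) \<in> above m n r u\<close>] False ne q(2) by auto
      moreover have "a + n - (b - 1) = Suc (Suc k)"
        using ab by simp
      ultimately show False
        using uk by (simp add: mem_above a_def)
    qed
  qed
  then show ?thesis
    using nested region by blast
qed

section \<open>Walks as pairs of paths\<close>

abbreviation walk_steps :: "(int \<times> int) set" where
  "walk_steps \<equiv> {step_e, step_w, step_se, step_nw}"

definition ups :: "(int \<times> int) set \<Rightarrow> (int \<times> int) list \<Rightarrow> nat \<Rightarrow> nat" where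
  "ups S ws k = length (filter (\<lambda>s. s \<in> S) (take k ws))"

text \<open>The lower path has height \<open>x\<close>, which increases with \<open>e\<close> and \<open>se\<close>; the upper path has
  height \<open>x + 2 y\<close>, which increases with \<open>e\<close> and \<open>nw\<close>.\<close>

abbreviation lower :: "(int \<times> int) list \<Rightarrow> nat \<Rightarrow> nat" where
  "lower \<equiv> ups {step_e, step_se}"

abbreviation upper :: "(int \<times> int) list \<Rightarrow> nat \<Rightarrow> nat" where
  "upper \<equiv> ups {step_e, step_nw}"

lemma ups_0 [simp]: "ups S ws 0 = 0"
  by (simp add: ups_def)

lemma ups_Suc:
  "k < length ws \<Longrightarrow> ups S ws (Suc k) = ups S ws k + (if ws ! k \<in> S then 1 else 0)"
  by (simp add: ups_def take_Suc_conv_app_nth)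

lemma walk_position_ups:
  assumes "set ws \<subseteq> walk_steps" "k \<le> length ws"
  shows "walk_position s ws k =
    (fst s - int k + 2 * int (lower ws k), snd s + int (upper ws k) - int (lower ws k))"
  using assms(2)
proof (induction k)
  case 0
  show ?case
    by (simp add: walk_position_def zero_prod_def)
next
  case (Suc k)
  then have k: "k < length ws"
    by simp
  then have "ws ! k \<in> walk_steps"
    using assms(1) nth_mem by blast
  moreover have "walk_position s ws (Suc k) = walk_position s ws k + ws ! k"
    using k by (simp add: walk_position_def take_Suc_conv_app_nth add.assoc)
  ultimately show ?case
    using Suc k by (auto simp: ups_Suc)
qed

lemma quadrant_walks_iff_nested_staircases:
  assumes ws: "set ws \<subseteq> walk_steps" "length ws = m + n"
  shows "ws \<in> quadrant_walks walk_steps (int n - r, 0) (int m - r, 0) (m + n) \<longleftrightarrow>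
    nested_staircases m n r (lower ws) (upper ws)"
proof -
  have pos: "walk_position (int n - r, 0) ws k =
      (int n - r - int k + 2 * int (lower ws k), int (upper ws k) - int (lower ws k))"
    if "k \<le> m + n" for k
    using walk_position_ups[of ws k "(int n - r, 0)"] ws that by simp
  have steps: "\<forall>k<m + n. ups S ws (Suc k) = ups S ws k \<or> ups S ws (Suc k) = Suc (ups S ws k)"
    for S
    using ws(2) by (simp add: ups_Suc)
  have quadrant: "(\<forall>k\<le>m + n. walk_position (int n - r, 0) ws k \<in> first_quadrant) \<longleftrightarrow>
      (\<forall>k\<le>m + n. int k + r \<le> int n + 2 * int (lower ws k) \<and> lower ws k \<le> upper ws k)"
    by (auto simp: pos first_quadrant_def)
  have "walk_position (int n - r, 0) ws (m + n) = (int m - r, 0) \<longleftrightarrow>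
      lower ws (m + n) = m \<and> upper ws (m + n) = m"
    by (auto simp: pos)
  then have "ws \<in> quadrant_walks walk_steps (int n - r, 0) (int m - r, 0) (m + n) \<longleftrightarrow>
      (\<forall>k\<le>m + n. int k + r \<le> int n + 2 * int (lower ws k) \<and> lower ws k \<le> upper ws k) \<and>
      lower ws (m + n) = m \<and> upper ws (m + n) = m"
    using ws quadrant by (simp add: quadrant_walks_def)
  also have "\<dots> \<longleftrightarrow> nested_staircases m n r (lower ws) (upper ws)"
    using steps by (fastforce simp: nested_staircases_def staircase_def)
  finally show ?thesis .
qed

lemma no_w_e_on_axis_iff_no_common_valley:
  assumes ws: "set ws \<subseteq> walk_steps" "length ws = m + n"
    and nested: "nested_staircases m n r (lower ws) (upper ws)"
  shows "no_w_e_on_axis (int n - r, 0) ws \<longleftrightarrow>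
    (\<forall>k. Suc k < m + n \<longrightarrow> \<not> common_valley (lower ws) (upper ws) k)"
proof -
  have "ws ! k = step_w \<and> snd (walk_position (int n - r, 0) ws k) = 0 \<and> ws ! Suc k = step_e \<longleftrightarrow>
      common_valley (lower ws) (upper ws) k" if k: "Suc k < m + n" for k
  proof -
    have "ws ! k \<in> walk_steps" "ws ! Suc k \<in> walk_steps"
      using ws(2) k by (simp_all only: subsetD[OF ws(1) nth_mem] Suc_lessD)
    moreover have "snd (walk_position (int n - r, 0) ws k) = 0 \<longleftrightarrow> upper ws k = lower ws k"
      using walk_position_ups[OF ws(1), of k] ws(2) k by auto
    moreover have "lower ws k \<le> upper ws k" "lower ws (Suc (Suc k)) \<le> upper ws (Suc (Suc k))"
      using nested k by (auto simp: nested_staircases_def)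
    moreover have "ups S ws (Suc k) = ups S ws k + (if ws ! k \<in> S then 1 else 0)"
      "ups S ws (Suc (Suc k)) = ups S ws (Suc k) + (if ws ! Suc k \<in> S then 1 else 0)" for S
      using ups_Suc[of k ws S] ups_Suc[of "Suc k" ws S] ws(2) k by auto
    ultimately show ?thesis
      unfolding common_valley_def by auto
  qed
  then show ?thesis
    using ws(2) by (auto simp: no_w_e_on_axis_def)
qed

lemma walk_eq_if_ups_eq:
  assumes "set ws \<subseteq> walk_steps" "set ws' \<subseteq> walk_steps" "length ws = N" "length ws' = N"
    and eq: "\<And>k. k \<le> N \<Longrightarrow> lower ws k = lower ws' k \<and> upper ws k = upper ws' k"
  shows "ws = ws'"
proof (rule nth_equalityI)
  fix k assume "k < length ws"
  then have k: "k < N"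
    using assms by simp
  have mem: "ws ! k \<in> walk_steps"
    using assms(1,3) k nth_mem by blast
  have mem': "ws' ! k \<in> walk_steps"
    using assms(2,4) k nth_mem by blast
  have same: "ws ! k \<in> S \<longleftrightarrow> ws' ! k \<in> S"
    if "ups S ws (Suc k) = ups S ws' (Suc k)" "ups S ws k = ups S ws' k" for S
  proof -
    have "(if ws ! k \<in> S then 1 else 0 :: nat) = (if ws' ! k \<in> S then 1 else 0)"
      using that k assms(3,4) by (simp add: ups_Suc)
    then show ?thesis
      by (simp split: if_splits)
  qed
  have "ws ! k \<in> {step_e, step_se} \<longleftrightarrow> ws' ! k \<in> {step_e, step_se}"
    using eq[of k] eq[of "Suc k"] k by (intro same) auto
  moreover have "ws ! k \<in> {step_e, step_nw} \<longleftrightarrow> ws' ! k \<in> {step_e, step_nw}"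
    using eq[of k] eq[of "Suc k"] k by (intro same) auto
  ultimately show "ws ! k = ws' ! k"
    using mem mem' by auto
qed (use assms in simp)

lemma exists_walk_of_staircases:
  assumes u: "staircase m n r u" and v: "staircase m n r v"
  shows "\<exists>ws. set ws \<subseteq> walk_steps \<and> length ws = m + n \<and>
    (\<forall>k\<le>m + n. lower ws k = u k \<and> upper ws k = v k)"
proof -
  define ws where "ws = map (\<lambda>k.
    if u (Suc k) = u k then if v (Suc k) = v k then step_w else step_nw
    else if v (Suc k) = v k then step_se else step_e) [0..<m + n]"
  have "lower ws k = u k \<and> upper ws k = v k" if "k \<le> m + n" for k
    using that
  proof (induction k)
    case 0
    show ?case
      using u v by (simp add: staircase_def)
  next
    case (Suc k)
    have "u (Suc k) = u k \<or> u (Suc k) = Suc (u k)" "v (Suc k) = v k \<or> v (Suc k) = Suc (v k)"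
      using u v Suc.prems by (auto simp: staircase_def)
    moreover have "k < length ws"
      using Suc.prems by (simp add: ws_def)
    ultimately show ?case
      using Suc by (auto simp: ups_Suc) (auto simp: ws_def)
  qed
  moreover have "set ws \<subseteq> walk_steps" "length ws = m + n"
    by (auto simp: ws_def)
  ultimately show ?thesis
    by blast
qed

lemma nested_staircases_cong:
  assumes "\<And>k. k \<le> m + n \<Longrightarrow> u k = u' k \<and> v k = v' k"
  shows "nested_staircases m n r u v \<longleftrightarrow> nested_staircases m n r u' v'"
  using assms by (simp add: nested_staircases_def staircase_def)

lemma above_cong:
  assumes "\<And>k. k \<le> m + n \<Longrightarrow> u k = u' k"
  shows "above m n r u = above m n r u'"
  using assms by (auto simp: mem_above mem_truncated_rectangle)

text \<open>The bijection is easiest to describe from walks to interval-closed sets: a walk is sent to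
  the region between its two paths.\<close>

theorem theorem4p5:
  fixes m n :: nat and r :: int
  assumes "r \<le> int m" and "r \<le> int n"
  shows "\<exists>f. bij_betw f
           (interval_closed_sets (truncated_rectangle m n r))
           {ws \<in> quadrant_walks {step_e, step_w, step_se, step_nw}
                   (int n - r, 0) (int m - r, 0) (m + n).
              no_w_e_on_axis (int n - r, 0) ws}"
proof -
  define W where "W = {ws \<in> quadrant_walks {step_e, step_w, step_se, step_nw}
                   (int n - r, 0) (int m - r, 0) (m + n).
              no_w_e_on_axis (int n - r, 0) ws}"
  define region where "region ws = above m n r (lower ws) - above m n r (upper ws)" for ws
  have W: "ws \<in> W \<longleftrightarrow> set ws \<subseteq> walk_steps \<and> length ws = m + n \<and>
      nested_staircases m n r (lower ws) (upper ws) \<and>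
      (\<forall>k. Suc k < m + n \<longrightarrow> \<not> common_valley (lower ws) (upper ws) k)" for ws
  proof (cases "set ws \<subseteq> walk_steps \<and> length ws = m + n")
    case True
    then show ?thesis
      unfolding W_def
      using quadrant_walks_iff_nested_staircases[of ws m n r]
        no_w_e_on_axis_iff_no_common_valley[of ws m n r] by blast
  next
    case False
    then show ?thesis
      by (auto simp: W_def quadrant_walks_def)
  qed
  have "bij_betw region W (interval_closed_sets (truncated_rectangle m n r))"
    unfolding bij_betw_def
  proof (intro conjI inj_onI equalityI subsetI)
    fix ws ws' assume ws: "ws \<in> W" "ws' \<in> W" "region ws = region ws'"
    have "lower ws k = lower ws' k \<and> upper ws k = upper ws' k" if "k \<le> m + n" for k
      by (rule region_determines_staircases[OF _ _ _ _ _ that]) (use ws W in \<open>auto simp: region_def\<close>)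
    then show "ws = ws'"
      using walk_eq_if_ups_eq[of ws ws' "m + n"] ws W by blast
  next
    fix I assume "I \<in> region ` W"
    then show "I \<in> interval_closed_sets (truncated_rectangle m n r)"
      using region_interval_closed W by (auto simp: region_def nested_staircases_def)
  next
    fix I assume "I \<in> interval_closed_sets (truncated_rectangle m n r)"
    then obtain u v where uv: "nested_staircases m n r u v"
      "\<And>k. Suc k < m + n \<Longrightarrow> \<not> common_valley u v k" "above m n r u - above m n r v = I"
      using exists_staircases_of_interval_closed[OF assms] by blast
    then obtain ws where ws: "set ws \<subseteq> walk_steps" "length ws = m + n"
      "\<And>k. k \<le> m + n \<Longrightarrow> lower ws k = u k \<and> upper ws k = v k"
      using exists_walk_of_staircases[of m n r u v] by (auto simp: nested_staircases_def)
    have "nested_staircases m n r (lower ws) (upper ws)"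
      using nested_staircases_cong[of m n "lower ws" u "upper ws" v] ws(3) uv(1) by blast
    moreover have "\<not> common_valley (lower ws) (upper ws) k" if "Suc k < m + n" for k
      using uv(2)[OF that] ws(3) that by (simp add: common_valley_def)
    ultimately have "ws \<in> W"
      using W ws by blast
    moreover have "region ws = I"
      unfolding region_def
      using above_cong[of m n "lower ws" u r] above_cong[of m n "upper ws" v r] ws(3) uv(3) by simp
    ultimately show "I \<in> region ` W"
      by blast
  qed
  then show ?thesis
    unfolding W_def using bij_betw_inv_into by blast
qed

end
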